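(* Let $\alpha,\beta>0$ and $n\in\mathbb{N}$ be given. Then there exist $\alpha^*,\beta^*>0$ such that $(a_1,a_2,a_3,a_4)=(-1,1,\alpha^*+\mathrm{i}\beta^*,\alpha^*-\mathrm{i}\beta^* )$ is a $\mathbf{T}_n$-tuple and $$\bigl|(\alpha+\mathrm{i}\beta)-(\alpha^*+\mathrm{i}\beta^* )\bigr|\le\frac{A}{n},$$ where $A$ is a constant independent of $n$.
   Context: Four pairwise distinct points $a_1,a_2,a_3,a_4\in\mathbb{C}$ are called a $\mathbf{T}_n$-tuple if there exist a polynomial $\mathcal{T}_n$ of degree $n$ and a polynomial $\mathcal{U}_{n-2}$ of degree $n-2$ (with complex coefficients) such that $\mathcal{T}_n^2(z)-(z-a_1)(z-a_2)(z-a_3)(z-a_4)\,\mathcal{U}_{n-2}^2(z)=1$ holds identically in $z$.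
   Formalization: The claim is proved for n ≥ 3 only: for n = 2 the defining identity forces α* = 0, so no tuple with α* > 0 exists, and for n = 1 there is no polynomial of degree n − 2. *)

theory Defs
  imports Complex_Main "HOL-Computational_Algebra.Polynomial"
begin

text \<open>
  The condition on the degree of \<open>U\<close> is stated additively, because \<open>n - 2\<close> is truncated on
  the natural numbers; in particular there are no tuples for \<open>n < 2\<close>. For \<open>n \<ge> 2\<close> the
  identity itself rules out \<open>U = 0\<close>, which has degree \<open>0\<close> in the library.
\<close>
definition T_tuple :: "nat \<Rightarrow> complex \<Rightarrow> complex \<Rightarrow> complex \<Rightarrow> complex \<Rightarrow> bool" where
  "T_tuple n a1 a2 a3 a4 \<longleftrightarrow>
     distinct [a1, a2, a3, a4] \<and>
     (\<exists>T U :: complex poly. degree T = n \<and> degree U + 2 = n \<and>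
        (\<forall>z. (poly T z)\<^sup>2 - (z - a1) * (z - a2) * (z - a3) * (z - a4) * (poly U z)\<^sup>2 = 1))"

end

theory Submission
  imports Defs "HOL-Analysis.Analysis"
begin

text \<open>
  Let \<open>H = (z\<^sup>2 - 1) ((z - a)\<^sup>2 + b\<^sup>2)\<close>. The Pell equation \<open>T\<^sup>2 - H U\<^sup>2 = 1\<close> is solvable in degree \<open>n\<close>
  as soon as the difference of the two points at infinity of the real elliptic curve \<open>y\<^sup>2 = H(z)\<close> is
  annihilated by \<open>n\<close>. The real points form one oval, on which the addition of this difference is a
  rotation with respect to the invariant differential \<open>dz/y\<close>; its angle \<open>\<theta>(a, b)\<close> is a quotient of
  complete elliptic integrals, and the condition becomes \<open>n \<theta> \<in> \<int>\<close>. With \<open>a\<^sup>2 + b\<^sup>2\<close> held fixed,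
  \<open>\<theta>\<close> decreases in \<open>a\<close> at a rate bounded below, so moving \<open>a\<close> by \<open>O(1/n)\<close> makes \<open>n \<theta>\<close> pass an
  integer. The finitely many small \<open>n\<close> only need some solution; with \<open>a\<^sup>2 + b\<^sup>2 = 1\<close> the angle
  takes every value in \<open>(0, 1/2]\<close>, hence \<open>1/n\<close>.
\<close>

subsection \<open>The continued fraction step\<close>

text \<open>Equality of the leading coefficients, not only of their squares, means that the pole of
  \<open>p + q sqrt H\<close> is at the point at infinity with \<open>sqrt H \<sim> z\<^sup>2\<close>.\<close>
definition pell_lead :: "'a::field_char_0 poly \<Rightarrow> 'a poly \<Rightarrow> bool" where
  "pell_lead p q \<longleftrightarrow>
     p = 1 \<and> q = 0 \<or> q \<noteq> 0 \<and> degree p = degree q + 2 \<and> lead_coeff p = lead_coeff q"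

text \<open>
  One step of the continued fraction of \<open>sqrt H\<close>: multiply \<open>p + q sqrt H\<close> by
  \<open>(m + sqrt H) / (1 - x z)\<close>. The root of the norm moves from \<open>1/x\<close> to \<open>1/y\<close>, where \<open>0\<close> stands
  for a root at infinity.
\<close>
lemma pell_step:
  fixes p q m H :: "'a::field_char_0 poly"
  assumes norm: "p\<^sup>2 - H * q\<^sup>2 = smult l [:1, -x:]"
    and quad: "m\<^sup>2 - H = smult \<mu> ([:1, -x:] * [:1, -y:])"
    and m: "degree m = 2" "lead_coeff m = 1"
    and root: "x \<noteq> 0 \<Longrightarrow> poly p (1 / x) + poly m (1 / x) * poly q (1 / x) = 0"
    and lead: "pell_lead p q"
  obtains p' q' where
    "p'\<^sup>2 - H * q'\<^sup>2 = smult (l * \<mu>) [:1, -y:]"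
    "\<And>z. y * z = 1 \<Longrightarrow> poly p' z = poly m z * poly q' z"
    "pell_lead p' q'"
    "degree p' = degree p + (if x = 0 then 2 else 1)"
proof -
  let ?X = "[:1, -x:]" and ?Y = "[:1, -y:]"
  \<comment> \<open>The coefficient of \<open>sqrt H\<close> in the product
    \<open>(p + q sqrt H) (m + sqrt H)\<close>; dividing it by \<open>?X\<close> gives the new
    \<open>q'\<close>.\<close>
  define r where "r = m * q + p"
  have m0: "m \<noteq> 0" using m by auto
  have r: "degree r = degree p \<and> r \<noteq> 0 \<and> degree q < degree r + 1 \<and> (q \<noteq> 0 \<longrightarrow> degree q + 2 = degree r)"
  proof (cases "q = 0")
    case True
    then show ?thesis using lead by (auto simp: r_def pell_lead_def)
  next
    case False
    then have l: "degree p = degree q + 2" "lead_coeff p = lead_coeff q"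
      using lead by (auto simp: pell_lead_def)
    have dm: "degree (m * q) = degree p" using m False m0 l by (simp add: degree_mult_eq)
    \<comment> \<open>Because the leading coefficients agree in sign, they add up instead of
      cancelling, and the degree of \<open>r\<close> does not drop.\<close>
    have "coeff r (degree p) = lead_coeff (m * q) + lead_coeff p"
      by (simp add: r_def dm)
    also have "\<dots> = 2 * lead_coeff q" using m l by (simp add: lead_coeff_mult)
    finally have c: "coeff r (degree p) \<noteq> 0" using False by simp
    have "degree r \<le> degree p" unfolding r_def by (rule degree_add_le) (use dm in auto)
    with c have "degree r = degree p" "r \<noteq> 0" using le_degree[OF c] by auto
    then show ?thesis using l by auto
  qed
  have "?X dvd r"
  proof (cases "x = 0")
    case True then show ?thesis
      by (metis dvd_refl minus_zero one_dvd one_poly_eq_simps(1) pCons_0_0)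
  next
    case False
    have "poly r (1 / x) = 0" using root[OF False] by (simp add: r_def algebra_simps)
    then obtain k where k: "r = [:- (1 / x), 1:] * k" unfolding poly_eq_0_iff_dvd by (elim dvdE)
    have "?X = smult (- x) [:- (1 / x), 1:]" using False by simp
    then have "r = ?X * smult (- 1 / x) k" unfolding k using False
      by (simp only: mult_smult_left mult_smult_right smult_smult) simp
    then show ?thesis by (rule dvdI)
  qed
  then obtain q' where q': "r = ?X * q'" by (elim dvdE)
  have X0: "?X \<noteq> 0" by simp
  have q'0: "q' \<noteq> 0" using r q' by auto
  have "degree r = degree ?X + degree q'" using q' X0 q'0 by (metis degree_mult_eq)
  then have dq': "degree p = degree q' + (if x = 0 then 0 else 1)" using r by auto
  \<comment> \<open>This is \<open>(m * p + H * q) / ?X\<close>, written without division by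
    substituting \<open>H = m^2 - \<mu> ?X ?Y\<close>.\<close>
  define p' where "p' = m * q' - smult \<mu> (?Y * q)"
  have small: "degree (smult \<mu> (?Y * q)) < degree (m * q')"
  proof -
    have "degree (m * q') = degree q' + 2" using m m0 q'0 by (simp add: degree_mult_eq)
    moreover have "degree (smult \<mu> (?Y * q)) < degree q' + 2"
    proof (cases "q = 0")
      case False
      have "degree (smult \<mu> (?Y * q)) \<le> degree (?Y * q)" by (rule degree_smult_le)
      also have "\<dots> \<le> degree ?Y + degree q" by (rule degree_mult_le)
      also have "\<dots> \<le> 1 + degree q" by simp
      finally show ?thesis using r False dq' by (auto split: if_splits)
    qed simp
    ultimately show ?thesis by simp
  qed
  have dp': "degree p' = degree q' + 2"
  proof -
    have "degree (m * q') = degree q' + 2" using m m0 q'0 by (simp add: degree_mult_eq)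
    then show ?thesis unfolding p'_def using small degree_add_eq_left[of "- smult \<mu> (?Y * q)" "m * q'"]
      by simp
  qed
  have lp': "lead_coeff p' = lead_coeff q'"
  proof -
    have "lead_coeff p' = lead_coeff (m * q')"
      unfolding p'_def using small lead_coeff_add_le[of "m*q'" "- smult \<mu> (?Y * q)"]
      by (smt (verit) add.commute add_uminus_conv_diff degree_minus lead_coeff_add_le)
    then show ?thesis using m by (simp add: lead_coeff_mult)
  qed
  have Xp': "?X * p' = m * p + H * q"
  proof -
    have "?X * p' = m * (?X * q') - smult \<mu> (?X * ?Y) * q"
      by (simp only: p'_def right_diff_distrib mult_smult_left mult_smult_right
          mult.assoc mult.left_commute)
    also have "\<dots> = m * (m * q + p) - (m\<^sup>2 - H) * q" using q' quad by (simp add: r_def)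
    finally show ?thesis by (simp add: algebra_simps power2_eq_square)
  qed
  have "?X\<^sup>2 * (p'\<^sup>2 - H * q'\<^sup>2) = (?X * p')\<^sup>2 - H * (?X * q')\<^sup>2"
    by (simp only: power_mult_distrib right_diff_distrib mult.left_commute)
  also have "\<dots> = (m * p + H * q)\<^sup>2 - H * (m * q + p)\<^sup>2"
    by (simp only: Xp' q'[symmetric] r_def)
  also have "\<dots> = (m\<^sup>2 - H) * (p\<^sup>2 - H * q\<^sup>2)"
    by (simp only: power2_eq_square) (simp add: algebra_simps)
  also have "\<dots> = ?X\<^sup>2 * smult (l * \<mu>) ?Y"
    unfolding norm quad by (simp only: power2_eq_square mult_smult_left mult_smult_right
        smult_smult mult.assoc mult.commute mult.left_commute)
  finally have n': "p'\<^sup>2 - H * q'\<^sup>2 = smult (l * \<mu>) ?Y" using X0 by (subst (asm) mult_cancel_left) simp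
  show thesis
  proof (rule that[of p' q'])
    show "poly p' z = poly m z * poly q' z" if "y * z = 1" for z
      using that unfolding p'_def by (simp add: mult.commute)
    show "pell_lead p' q'" using q'0 dp' lp' by (simp add: pell_lead_def)
  qed (use n' q'0 dp' dq' in auto)
qed

subsection \<open>The flow on the real oval\<close>

text \<open>A Gronwall argument: the energy \<open>e^2 + e'^2\<close>, damped by
  \<open>exp (- (1 + L) t)\<close>, does not increase and starts at zero.\<close>

lemma linear_ode_unique:
  fixes e e' g :: "real \<Rightarrow> real"
  assumes e: "\<And>t. (e has_real_derivative e' t) (at t)"
    and e': "\<And>t. (e' has_real_derivative g t * e t) (at t)"
    and g: "\<And>t. \<bar>g t\<bar> \<le> L"
    and init: "e 0 = 0" "e' 0 = 0" and "t \<ge> 0"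
  shows "e t = 0"
proof -
  define E where "E = (\<lambda>t. ((e t)\<^sup>2 + (e' t)\<^sup>2) * exp (- ((1 + L) * t)))"
  have "E t \<le> E 0"
  proof (rule DERIV_nonpos_imp_nonincreasing[OF \<open>t \<ge> 0\<close>])
    fix x
    have "(E has_real_derivative
       (2 * e x * e' x * (1 + g x) - (1 + L) * ((e x)\<^sup>2 + (e' x)\<^sup>2)) * exp (- ((1 + L) * x))) (at x)"
      unfolding E_def by (rule derivative_eq_intros e e' refl | simp)+ (simp add: algebra_simps)
    moreover have "2 * e x * e' x * (1 + g x) \<le> (1 + L) * ((e x)\<^sup>2 + (e' x)\<^sup>2)"
    proof -
      have "2 * e x * e' x * (1 + g x) \<le> \<bar>2 * e x * e' x\<bar> * \<bar>1 + g x\<bar>"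
        by (metis abs_ge_self abs_mult)
      also have "\<dots> \<le> ((e x)\<^sup>2 + (e' x)\<^sup>2) * (1 + L)"
      proof (rule mult_mono)
        show "\<bar>2 * e x * e' x\<bar> \<le> (e x)\<^sup>2 + (e' x)\<^sup>2"
          using sum_squares_bound[of "\<bar>e x\<bar>" "\<bar>e' x\<bar>"] by (simp add: abs_mult)
        show "\<bar>1 + g x\<bar> \<le> 1 + L" using g[of x] by linarith
      qed auto
      finally show ?thesis by (simp add: mult.commute)
    qed
    ultimately show "\<exists>y. (E has_real_derivative y) (at x) \<and> y \<le> 0"
      by (intro exI conjI) (auto simp: mult_le_0_iff)
  qed
  then have "(e t)\<^sup>2 + (e' t)\<^sup>2 \<le> 0" using init by (simp add: E_def mult_le_0_iff)
  then show ?thesis by (simp add: sum_power2_le_zero_iff)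
qed

lemma quad_pos:
  fixes a s x :: real
  assumes "a\<^sup>2 < s" shows "1 - 2 * a * x + s * x\<^sup>2 > 0"
proof (cases "x = 0")
  case False
  have "1 - 2 * a * x + s * x\<^sup>2 = (1 - a * x)\<^sup>2 + (s - a\<^sup>2) * x\<^sup>2"
    by (simp add: power2_eq_square algebra_simps)
  also have "\<dots> > 0" using assms False by (intro add_nonneg_pos) auto
  finally show ?thesis .
qed simp

text \<open>
  In the coordinate \<open>u = 1/z\<close> the curve is \<open>v\<^sup>2 = (1 - u\<^sup>2) (1 - 2 a u + s u\<^sup>2)\<close> with
  \<open>s = a\<^sup>2 + b\<^sup>2\<close>, and the substitution \<open>u = sin \<phi>\<close> makes the invariant differential \<open>du/v\<close>
  smooth on the whole real oval. The function \<open>\<Phi>\<close> expresses \<open>\<phi>\<close> through the integral \<open>t\<close> of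
  this differential. The points at infinity \<open>(u, v) = (0, 1)\<close> and \<open>(0, -1)\<close> are at \<open>t = 0\<close> and
  \<open>t = w1\<close>, and their difference is the translation by \<open>w2\<close>.
\<close>
locale oval_flow =
  fixes a s w1 w2 :: real and \<Phi> :: "real \<Rightarrow> real"
  assumes as: "a\<^sup>2 < s"
    and flow0: "\<Phi> 0 = 0"
    and flow_deriv: "\<And>t. (\<Phi> has_real_derivative
          sqrt (1 - 2 * a * sin (\<Phi> t) + s * (sin (\<Phi> t))\<^sup>2)) (at t)"
    and flow_reflect: "\<And>t. \<Phi> (w1 - t) = pi - \<Phi> t"
    and flow_period: "\<And>t. \<Phi> (t + (w1 + w2)) = \<Phi> t + 2 * pi"
begin

lemma s_pos: "s > 0" using as by (smt (verit) zero_le_power2)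

definition d :: "real \<Rightarrow> real" where "d x = 1 - 2 * a * x + s * x\<^sup>2"

lemma d_pos: "d x > 0"
  using quad_pos[OF as] by (simp add: d_def)

definition u :: "real \<Rightarrow> real" where "u t = sin (\<Phi> t)"
definition v :: "real \<Rightarrow> real" where "v t = cos (\<Phi> t) * sqrt (d (u t))"

lemma v_square: "(v t)\<^sup>2 = (1 - (u t)\<^sup>2) * d (u t)"
  using d_pos[of "u t"] by (simp add: v_def power_mult_distrib u_def cos_squared_eq)

lemma u_deriv: "(u has_real_derivative v t) (at t)"
  unfolding u_def v_def d_def
  by (rule derivative_eq_intros flow_deriv refl | simp)+

text \<open>Differentiating \<open>v_square\<close> would leave the zeros of \<open>v\<close> open.
  In the product of the cosine and the positive root everything is smooth, and the root
  cancels.\<close>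

lemma v_deriv: "(v has_real_derivative (1 - (u t)\<^sup>2) * (s * u t - a) - u t * d (u t)) (at t)"
proof -
  have D: "sqrt (d (u t)) > 0" "sqrt (d (u t)) * sqrt (d (u t)) = d (u t)"
    using d_pos[of "u t"] by auto
  have \<Phi>: "(\<Phi> has_real_derivative sqrt (d (u t))) (at t)"
    using flow_deriv[of t] by (simp add: d_def u_def)
  have d: "((\<lambda>t. d (u t)) has_real_derivative (2 * s * u t - 2 * a) * v t) (at t)"
    unfolding d_def by (rule derivative_eq_intros u_deriv refl | simp)+ (simp add: algebra_simps)
  have "((\<lambda>t. sqrt (d (u t))) has_real_derivative
       inverse (sqrt (d (u t))) / 2 * ((2 * s * u t - 2 * a) * v t)) (at t)"
    using DERIV_chain2[OF DERIV_real_sqrt[OF d_pos] d] .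
  also have "inverse (sqrt (d (u t))) / 2 * ((2 * s * u t - 2 * a) * v t) = (s * u t - a) * cos (\<Phi> t)"
    using D by (simp add: v_def field_simps)
  finally have sd: "((\<lambda>t. sqrt (d (u t))) has_real_derivative (s * u t - a) * cos (\<Phi> t)) (at t)" .
  have "(v has_real_derivative
       - sin (\<Phi> t) * sqrt (d (u t)) * sqrt (d (u t)) + (s * u t - a) * cos (\<Phi> t) * cos (\<Phi> t)) (at t)"
    unfolding v_def by (rule derivative_eq_intros \<Phi> sd refl | simp)+
  moreover have "(cos (\<Phi> t))\<^sup>2 = 1 - (u t)\<^sup>2" by (simp add: u_def cos_squared_eq)
  ultimately show ?thesis
    using d_pos[of "u t"] by (simp add: mult.assoc u_def power2_eq_square) (simp add: algebra_simps)
qed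

text \<open>
  The parabola \<open>v = 1 - a u + c u\<^sup>2\<close> through a point of the oval is tangent to the curve at
  \<open>(0, 1)\<close>; up to the sign of \<open>v\<close>, its parameter \<open>c\<close> is the Weierstrass function of the curve with
  a double pole at \<open>t = w1\<close>. As \<open>c < s\<close> on the oval, \<open>W = 1 / (s - c)\<close> is smooth, and its
  closed form below arises by rationalising the denominator. The identities for \<open>W\<close> and its
  derivative all come from \<open>W\<^sup>2 K(u) - 2 m(u) W + u\<^sup>2 = 0\<close>, read as a quadratic equation in \<open>u\<close>.
\<close>
definition m :: "real \<Rightarrow> real" where "m x = 1 - a * x + s * x\<^sup>2"
definition K :: "real \<Rightarrow> real" where "K x = (s * x - a)\<^sup>2 + d x + s"
definition W :: "real \<Rightarrow> real" where "W t = (v t + m (u t)) / K (u t)"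
definition M :: "real \<Rightarrow> real" where "M w = a * (s + 1) * w\<^sup>2 - a * w"
definition N :: "real \<Rightarrow> real" where "N w = (s * w - 1)\<^sup>2 + s * w\<^sup>2"

lemma K_gt: "K x > s" using d_pos[of x] by (simp add: K_def add_nonneg_pos)
lemma K_pos: "K x > 0" using K_gt[of x] s_pos by linarith

text \<open>\<open>m\<close> is the parabola with \<open>c = s\<close>; the factor
  \<open>x^2\<close> is its tangency at \<open>(0, 1)\<close>. The cofactor \<open>K\<close> is the
  denominator left when \<open>u^2 / (m - v)\<close> is rationalised.\<close>

lemma m_square: "(m x)\<^sup>2 - (1 - x\<^sup>2) * d x = x\<^sup>2 * K x"
  unfolding m_def d_def K_def by algebra

lemma W_K: "W t * K (u t) = v t + m (u t)"
  using K_pos[of "u t"] by (simp add: W_def)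

lemma W_m: "W t * (m (u t) - v t) = (u t)\<^sup>2"
proof -
  have "K (u t) * (W t * (m (u t) - v t)) = (v t + m (u t)) * (m (u t) - v t)"
    by (simp add: W_K[symmetric])
  also have "\<dots> = (m (u t))\<^sup>2 - (v t)\<^sup>2" by algebra
  also have "\<dots> = K (u t) * (u t)\<^sup>2" using m_square[of "u t"] by (simp add: v_square)
  finally show ?thesis using K_pos[of "u t"] by simp
qed

lemma W_zero_iff: "W t = 0 \<longleftrightarrow> u t = 0 \<and> v t = -1"
proof
  assume "W t = 0"
  then show "u t = 0 \<and> v t = -1" using W_m[of t] W_K[of t] by (auto simp: m_def)
next
  assume "u t = 0 \<and> v t = -1"
  then show "W t = 0" by (simp add: W_def m_def)
qed

lemma W_deriv: "(W has_real_derivative M (W t) - u t * N (W t)) (at t)"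
proof -
  let ?x = "u t" and ?y = "v t"
  let ?v' = "(1 - ?x\<^sup>2) * (s * ?x - a) - ?x * d ?x"
  let ?m' = "(2 * s * ?x - a) * ?y" and ?K' = "(2 * s * (s * ?x - a) + (2 * s * ?x - 2 * a)) * ?y"
  have m': "((\<lambda>t. m (u t)) has_real_derivative ?m') (at t)"
    unfolding m_def by (rule derivative_eq_intros u_deriv refl | simp)+ (simp add: algebra_simps)
  have K': "((\<lambda>t. K (u t)) has_real_derivative ?K') (at t)"
    unfolding K_def d_def by (rule derivative_eq_intros u_deriv refl | simp)+ (simp add: algebra_simps)
  have Kn: "K ?x \<noteq> 0" using K_pos[of ?x] by simp
  have D: "(W has_real_derivative
      ((?v' + ?m') * K ?x - (?y + m ?x) * ?K') / (K ?x * K ?x)) (at t)"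
    unfolding W_def using DERIV_divide[OF DERIV_add[OF v_deriv[of t] m'] K' Kn] .
  have "K ?x * K ?x * (M (W t) - ?x * N (W t)) =
     a * (s + 1) * (W t * K ?x)\<^sup>2 - a * (W t * K ?x) * K ?x
     - ?x * ((s * (W t * K ?x) - K ?x)\<^sup>2 + s * (W t * K ?x)\<^sup>2)"
    by (simp add: M_def N_def power2_eq_square algebra_simps)
  also have "\<dots> = (?v' + ?m') * K ?x - (?y + m ?x) * ?K'"
    using v_square[of t] by (simp only: W_K) (unfold m_def K_def d_def, algebra)
  finally have "((?v' + ?m') * K ?x - (?y + m ?x) * ?K') / (K ?x * K ?x) = M (W t) - ?x * N (W t)"
    using Kn by (simp add: field_simps)
  with D show ?thesis by simp
qed

text \<open>In this form \<open>M - u N\<close> is minus half the derivative in \<open>u\<close>, so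
  its square is a quarter of the discriminant, a quartic in \<open>W\<close>.\<close>

lemma quadratic_relation:
  "N (W t) * (u t)\<^sup>2 - 2 * M (W t) * u t + ((a\<^sup>2 + 1 + s) * (W t)\<^sup>2 - 2 * W t) = 0"
proof -
  have "(W t)\<^sup>2 * K (u t) - 2 * m (u t) * W t + (u t)\<^sup>2 =
      W t * (v t + m (u t)) - 2 * m (u t) * W t + W t * (m (u t) - v t)"
    by (simp add: W_K[symmetric] W_m power2_eq_square)
  also have "\<dots> = 0" by (simp add: algebra_simps)
  finally show ?thesis unfolding N_def M_def K_def d_def m_def by algebra
qed

definition W' :: "real \<Rightarrow> real" where "W' t = M (W t) - u t * N (W t)"

text \<open>\<open>W'\<^sup>2 = P(W)\<close> for a quartic \<open>P\<close>; these are the coefficients of \<open>P'/2\<close>.\<close>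
definition c1 :: real where "c1 = - 1 - 5 * s"
definition c2 :: real where "c2 = 3 * (s * (a\<^sup>2 + 1 + s) + s * (s + 1) - a\<^sup>2 * (s + 1))"
definition c3 :: real where "c3 = 2 * (a\<^sup>2 * (s + 1)\<^sup>2 - s * (s + 1) * (a\<^sup>2 + 1 + s))"

text \<open>Derived directly, since dividing the derivative of \<open>W'^2 = P(W)\<close> by
  \<open>W'\<close> fails at \<open>w1\<close>, where the initial values are taken. Unlike the
  first-order equation, this one determines \<open>W\<close> from them.\<close>

lemma W'_deriv:
  "(W' has_real_derivative 1 + c1 * W t + c2 * (W t)\<^sup>2 + c3 * (W t) ^ 3) (at t)"
proof -
  let ?w = "W t" and ?x = "u t"
  let ?w' = "M ?w - ?x * N ?w"
  have "(W' has_real_derivative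
      (2 * a * (s + 1) * ?w - a) * ?w'
      - (v t * N ?w + ?x * ((2 * s * (s * ?w - 1) + 2 * s * ?w) * ?w'))) (at t)"
    unfolding W'_def M_def N_def
    by (rule derivative_eq_intros W_deriv u_deriv refl | simp)+
      (simp add: M_def N_def power2_eq_square algebra_simps)
  moreover have "v t = ?w * K ?x - m ?x" by (simp add: W_K)
  then have "(2 * a * (s + 1) * ?w - a) * ?w'
      - (v t * N ?w + ?x * ((2 * s * (s * ?w - 1) + 2 * s * ?w) * ?w'))
      = 1 + c1 * ?w + c2 * ?w\<^sup>2 + c3 * ?w ^ 3"
    using quadratic_relation[of t]
    unfolding M_def N_def K_def d_def m_def c1_def c2_def c3_def by algebra
  ultimately show ?thesis by simp
qed

lemma u_bound: "\<bar>u t\<bar> \<le> 1"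
  by (simp add: u_def)

text \<open>Makes the cubic in \<open>W'_deriv\<close> Lipschitz along the orbit.\<close>

lemma W_bounded: obtains B where "\<And>t. \<bar>W t\<bar> \<le> B"
proof
  fix t
  have ax: "\<bar>a * u t\<bar> \<le> \<bar>a\<bar>" using u_bound[of t] by (simp add: abs_mult mult_left_le)
  have sx: "0 \<le> s * (u t)\<^sup>2" "s * (u t)\<^sup>2 \<le> s"
    using s_pos u_bound[of t] by (auto simp: abs_square_le_1 mult_left_le)
  have "\<bar>v t\<bar> \<le> \<bar>cos (\<Phi> t)\<bar> * sqrt (d (u t))"
    using d_pos[of "u t"] by (simp add: v_def abs_mult)
  also have "\<dots> \<le> 1 * sqrt (1 + 2 * \<bar>a\<bar> + s)"
    using ax sx d_pos[of "u t"] by (intro mult_mono) (auto simp: d_def)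
  finally have vb: "\<bar>v t\<bar> \<le> sqrt (1 + 2 * \<bar>a\<bar> + s)" by simp
  have mb: "\<bar>m (u t)\<bar> \<le> 1 + \<bar>a\<bar> + s" using ax sx unfolding m_def by linarith
  have "s * \<bar>W t\<bar> \<le> K (u t) * \<bar>W t\<bar>"
    using K_gt[of "u t"] by (intro mult_right_mono) auto
  also have "\<dots> = \<bar>v t + m (u t)\<bar>" using K_pos[of "u t"] by (simp add: W_K[symmetric] abs_mult)
  also have "\<dots> \<le> sqrt (1 + 2 * \<bar>a\<bar> + s) + (1 + \<bar>a\<bar> + s)" using vb mb by linarith
  finally show "\<bar>W t\<bar> \<le> (sqrt (1 + 2 * \<bar>a\<bar> + s) + (1 + \<bar>a\<bar> + s)) / s"
    using s_pos by (simp add: pos_le_divide_eq mult.commute)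
qed

lemma flow_w1: "\<Phi> w1 = pi"
  using flow_reflect[of 0] flow0 by simp

lemma W_w1: "W w1 = 0" "W' w1 = 0"
proof -
  show "W w1 = 0" unfolding W_zero_iff by (simp add: u_def v_def d_def flow_w1)
  then show "W' w1 = 0" by (simp add: W'_def M_def u_def flow_w1)
qed

text \<open>Both sides solve the same second-order equation with the same initial values. This evenness is
  what makes translations of the oval algebraic.\<close>
lemma W_even_nonneg:
  assumes "h \<ge> 0" shows "W (w1 + h) = W (w1 - h)"
proof -
  obtain B where B: "\<And>t. \<bar>W t\<bar> \<le> B" using W_bounded by blast
  have B0: "B \<ge> 0" using B[of 0] by linarith
  \<comment> \<open>The divided difference of the cubic in \<open>W'_deriv\<close>: with it, the
    difference of the two sides solves a linear equation.\<close>
  define g where "g = (\<lambda>h. let x = W (w1 + h); y = W (w1 - h) in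
      c1 + c2 * (x + y) + c3 * (x\<^sup>2 + x * y + y\<^sup>2))"
  have plus: "((\<lambda>h. w1 + h) has_real_derivative 1) (at h)"
    and minus: "((\<lambda>h. w1 - h) has_real_derivative -1) (at h)" for h
    by (rule derivative_eq_intros refl | simp)+
  have "W (w1 + h) - W (w1 - h) = 0"
  proof (rule linear_ode_unique[where e = "\<lambda>h. W (w1 + h) - W (w1 - h)"
        and e' = "\<lambda>h. W' (w1 + h) + W' (w1 - h)" and g = g
        and L = "\<bar>c1\<bar> + \<bar>c2\<bar> * (2 * B) + \<bar>c3\<bar> * (3 * B\<^sup>2)", OF _ _ _ _ _ assms])
    fix t
    show "((\<lambda>h. W (w1 + h) - W (w1 - h)) has_real_derivative W' (w1 + t) + W' (w1 - t)) (at t)"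
    proof -
      have *: "W' (w1 + t) + W' (w1 - t) = W' (w1 + t) * 1 - W' (w1 - t) * -1" by simp
      show ?thesis unfolding *
        by (unfold W'_def,
            rule DERIV_diff[OF DERIV_chain2[OF W_deriv plus] DERIV_chain2[OF W_deriv minus]])
    qed
    show "((\<lambda>h. W' (w1 + h) + W' (w1 - h)) has_real_derivative
        g t * (W (w1 + t) - W (w1 - t))) (at t)"
    proof -
      have *: "g t * (W (w1 + t) - W (w1 - t)) =
        (1 + c1 * W (w1 + t) + c2 * (W (w1 + t))\<^sup>2 + c3 * (W (w1 + t)) ^ 3) * 1 +
        (1 + c1 * W (w1 - t) + c2 * (W (w1 - t))\<^sup>2 + c3 * (W (w1 - t)) ^ 3) * -1"
        unfolding g_def Let_def by algebra
      show ?thesis unfolding *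
        by (rule DERIV_add[OF DERIV_chain2[OF W'_deriv plus] DERIV_chain2[OF W'_deriv minus]])
    qed
    show "\<bar>g t\<bar> \<le> \<bar>c1\<bar> + \<bar>c2\<bar> * (2 * B) + \<bar>c3\<bar> * (3 * B\<^sup>2)"
    proof -
      let ?x = "W (w1 + t)" and ?y = "W (w1 - t)"
      have "\<bar>?x + ?y\<bar> \<le> 2 * B" using B[of "w1 + t"] B[of "w1 - t"] by linarith
      then have 2: "\<bar>c2 * (?x + ?y)\<bar> \<le> \<bar>c2\<bar> * (2 * B)" by (simp add: abs_mult mult_left_mono)
      have sq: "?x\<^sup>2 \<le> B\<^sup>2" "?y\<^sup>2 \<le> B\<^sup>2" using B B0 by (auto simp: abs_le_square_iff[symmetric])
      have "\<bar>?x * ?y\<bar> \<le> B\<^sup>2" using B B0 by (simp add: abs_mult power2_eq_square mult_mono)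
      with sq have "\<bar>?x\<^sup>2 + ?x * ?y + ?y\<^sup>2\<bar> \<le> 3 * B\<^sup>2"
        using zero_le_power2[of ?x] zero_le_power2[of ?y] by linarith
      then have 3: "\<bar>c3 * (?x\<^sup>2 + ?x * ?y + ?y\<^sup>2)\<bar> \<le> \<bar>c3\<bar> * (3 * B\<^sup>2)"
        by (simp only: abs_mult mult_left_mono abs_ge_zero)
      show ?thesis using 2 3 unfolding g_def Let_def by linarith
    qed
  qed (use W_w1 in auto)
  then show ?thesis by simp
qed

section \<open>Translation of the oval by means of parabolas\<close>

lemma W_reflect: "W (2 * w1 - t) = W t"
  using W_even_nonneg[of "t - w1"] W_even_nonneg[of "w1 - t"]
  by (cases "t \<ge> w1") (auto simp: algebra_simps)

lemma W'_reflect: "W' (2 * w1 - t) = - W' t"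
proof -
  have "((\<lambda>t. 2 * w1 - t) has_real_derivative -1) (at t)"
    by (rule derivative_eq_intros refl | simp)+
  from DERIV_chain2[OF W_deriv this]
  have "(W has_real_derivative W' (2 * w1 - t) * -1) (at t)" by (simp add: W_reflect W'_def)
  from DERIV_unique[OF this W_deriv] show ?thesis by (simp add: W'_def)
qed

text \<open>Modulo the period \<open>w1 + w2\<close>, the translation by \<open>w2\<close> is the
  reflection at \<open>w1\<close> followed by \<open>t \<mapsto> w1 - t\<close>, which exchanges the
  two sheets.\<close>

lemma shift_w2: "u (t + w2) = u (2 * w1 - t)" "v (t + w2) = - v (2 * w1 - t)"
proof -
  have 1: "\<Phi> (t + w2) = pi - \<Phi> (w1 - t - w2)"
    using flow_reflect[of "w1 - t - w2"] by (simp add: algebra_simps)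
  have 2: "\<Phi> (2 * w1 - t) = \<Phi> (w1 - t - w2) + 2 * pi"
    using flow_period[of "w1 - t - w2"] by (simp add: algebra_simps)
  show "u (t + w2) = u (2 * w1 - t)" by (simp add: u_def 1 2)
  then show "v (t + w2) = - v (2 * w1 - t)" by (simp add: v_def 1 2)
qed

lemma parabola_point:
  assumes "W t \<noteq> 0"
  shows "v t = 1 - a * u t + (s - 1 / W t) * (u t)\<^sup>2"
proof -
  have "m (u t) - v t = (u t)\<^sup>2 / W t" using W_m[of t] assms by (simp add: field_simps)
  then show ?thesis by (simp add: m_def algebra_simps)
qed

text \<open>Since \<open>W\<close> is even about \<open>w1\<close>, the points at \<open>t\<close>
  and \<open>2 * w1 - t\<close> lie on the same parabola. The sum comes from the oddness of
  \<open>W'\<close>, which also covers a double root \<open>x = y\<close>.\<close>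

lemma vieta:
  assumes "W t \<noteq> 0"
  defines "c \<equiv> s - 1 / W t" and "x \<equiv> u t" and "y \<equiv> u (2 * w1 - t)"
  shows "(c\<^sup>2 + s) * (x + y) = 2 * a * (c + 1)"
    and "(c\<^sup>2 + s) * (x * y) = 2 * c + a\<^sup>2 - s + 1"
proof -
  let ?w = "W t"
  have cw: "c * ?w = s * ?w - 1" using assms(1) by (simp add: c_def left_diff_distrib)
  have N: "N ?w = (c\<^sup>2 + s) * ?w\<^sup>2"
    unfolding N_def cw[symmetric] by (simp add: power2_eq_square algebra_simps)
  have "N ?w * (x + y) = 2 * M ?w"
    using W'_reflect[of t] unfolding W'_def W_reflect x_def y_def by (simp add: algebra_simps)
  moreover have M: "M ?w = a * (c + 1) * ?w\<^sup>2"
    unfolding M_def using cw by algebra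
  ultimately have "?w\<^sup>2 * ((c\<^sup>2 + s) * (x + y)) = ?w\<^sup>2 * (2 * a * (c + 1))"
    unfolding N by (simp add: algebra_simps)
  then show sum: "(c\<^sup>2 + s) * (x + y) = 2 * a * (c + 1)" using assms(1) by simp
  have "?w\<^sup>2 * ((c\<^sup>2 + s) * (x * y)) = ?w\<^sup>2 * (2 * c + a\<^sup>2 - s + 1)"
    using quadratic_relation[of t] sum cw unfolding N M x_def[symmetric] by algebra
  then show "(c\<^sup>2 + s) * (x * y) = 2 * c + a\<^sup>2 - s + 1" using assms(1) by simp
qed

subsection \<open>The Pell equation\<close>

text \<open>The expansion of \<open>(z^2 - 1) (z^2 - 2 a z + s)\<close>. At \<open>z = 1/u\<close>
  the number \<open>v / u^2\<close> is one of its square roots.\<close>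

definition H :: "complex poly" where
  "H = [:of_real (- s), of_real (2 * a), of_real (s - 1), of_real (- 2 * a), 1:]"

text \<open>
  The divisor of \<open>p + q sqrt H\<close> has one moving zero, the \<open>k\<close>-th translate of the point at \<open>t = 0\<close>.
  When the orbit meets the point at \<open>t = w1\<close>, the next translate is the starting point and
  \<open>p\<close>, \<open>q\<close> do not change; this accounts for the lower degree.
\<close>
lemma pell_orbit:
  defines "t \<equiv> \<lambda>k. real k * w2"
  shows "\<exists>p q l. l \<noteq> 0 \<and> p\<^sup>2 - H * q\<^sup>2 = smult l [:1, - of_real (u (t k)):] \<and>
     (u (t k) \<noteq> 0 \<longrightarrow> poly p (1 / of_real (u (t k))) +
        of_real (v (t k) / (u (t k))\<^sup>2) * poly q (1 / of_real (u (t k))) = 0) \<and>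
     pell_lead p q \<and> degree p = (if u (t k) = 0 \<and> v (t k) = 1 then k else Suc k)"
proof (induction k)
  case 0
  have "u (t 0) = 0" "v (t 0) = 1" by (simp_all add: t_def u_def v_def d_def flow0)
  then show ?case
    by (intro exI[of _ 1] exI[of _ 0]) (simp add: pell_lead_def)
next
  case (Suc k)
  define x y where "x = u (t k)" and "y = u (2 * w1 - t k)"
  from Suc obtain p q l where l: "l \<noteq> 0"
    and norm: "p\<^sup>2 - H * q\<^sup>2 = smult l [:1, - of_real x:]"
    and root: "x \<noteq> 0 \<Longrightarrow> poly p (1 / of_real x) + of_real (v (t k) / x\<^sup>2) * poly q (1 / of_real x) = 0"
    and lead: "pell_lead p q" and deg: "degree p = (if x = 0 \<and> v (t k) = 1 then k else Suc k)"
    unfolding x_def by blast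
  have "t (Suc k) = t k + w2" by (simp add: t_def algebra_simps)
  then have next_pt: "u (t (Suc k)) = y" "v (t (Suc k)) = - v (2 * w1 - t k)"
    by (simp_all add: shift_w2 y_def)
  show ?case
  proof (cases "W (t k) = 0")
    case True
    then have "x = 0" "v (t k) = -1" by (simp_all add: W_zero_iff x_def)
    moreover have "y = 0" "v (2 * w1 - t k) = -1"
      using True W_zero_iff[of "2 * w1 - t k"] by (simp_all add: W_reflect y_def)
    ultimately show ?thesis using l norm lead deg unfolding next_pt
      by (intro exI[of _ p] exI[of _ q] exI[of _ l]) simp
  next
    case False
    define c where "c = s - 1 / W (t k)"
    have vx: "v (t k) = 1 - a * x + c * x\<^sup>2"
      using parabola_point[OF False] by (simp add: c_def x_def)
    have vy: "v (2 * w1 - t k) = 1 - a * y + c * y\<^sup>2"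
      using parabola_point[of "2 * w1 - t k"] False by (simp add: c_def y_def W_reflect)
    have sum: "(c\<^sup>2 + s) * (x + y) = 2 * a * (c + 1)"
      and prod: "(c\<^sup>2 + s) * (x * y) = 2 * c + a\<^sup>2 - s + 1"
      using vieta[OF False] unfolding c_def x_def y_def by simp_all
    define \<mu> where "\<mu> = c\<^sup>2 + s"
    have "\<mu> > 0" unfolding \<mu>_def using s_pos by (intro add_nonneg_pos) auto
    then have \<mu>0: "complex_of_real \<mu> \<noteq> 0" by simp
    \<comment> \<open>The parabola through the current point, multiplied by \<open>z^2\<close> and
      written in \<open>z = 1/u\<close>; it hides the function \<open>m\<close> of the
      locale.\<close>
    define m :: "complex poly" where "m = [:of_real c, of_real (- a), 1:]"
    have m_at: "poly m (1 / of_real z) = of_real ((1 - a * z + c * z\<^sup>2) / z\<^sup>2)" if "z \<noteq> 0" for z :: real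
      using that by (simp add: m_def field_simps power2_eq_square)
    have quad: "m\<^sup>2 - H = smult (of_real \<mu>) ([:1, - of_real x:] * [:1, - of_real y:])"
    proof -
      have 1: "complex_of_real \<mu> * (of_real x + of_real y) = 2 * of_real a * (of_real c + 1)"
        using arg_cong[OF sum, of complex_of_real] by (simp add: \<mu>_def)
      have 2: "complex_of_real \<mu> * (of_real x * of_real y)
          = 2 * of_real c + (of_real a)\<^sup>2 - of_real s + 1"
        using arg_cong[OF prod, of complex_of_real] by (simp add: \<mu>_def)
      have 3: "complex_of_real \<mu> = (of_real c)\<^sup>2 + of_real s" by (simp add: \<mu>_def)
      have "poly (m\<^sup>2 - H) z = poly (smult (of_real \<mu>) ([:1, - of_real x:] * [:1, - of_real y:])) z" for z
      proof -
        have "poly (m\<^sup>2 - H) z =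
           of_real \<mu> - 2 * of_real a * (of_real c + 1) * z
             + (2 * of_real c + (of_real a)\<^sup>2 - of_real s + 1) * z\<^sup>2"
          unfolding 3 by (simp add: m_def H_def power2_eq_square algebra_simps)
        also have "\<dots> = of_real \<mu> * ((1 - of_real x * z) * (1 - of_real y * z))"
          unfolding 1[symmetric] 2[symmetric] by (simp add: power2_eq_square algebra_simps)
        finally show ?thesis by (simp add: algebra_simps)
      qed
      then show ?thesis by (intro poly_eq_poly_eq_iff[THEN iffD1] ext)
    qed
    obtain p' q' where step: "p'\<^sup>2 - H * q'\<^sup>2 = smult (l * of_real \<mu>) [:1, - of_real y:]"
      "\<And>z. of_real y * z = 1 \<Longrightarrow> poly p' z = poly m z * poly q' z"
      "pell_lead p' q'" "degree p' = degree p + (if complex_of_real x = 0 then 2 else 1)"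
    proof (rule pell_step[OF norm quad _ _ _ lead])
      show "degree m = 2" "lead_coeff m = 1" by (simp_all add: m_def)
      show "poly p (1 / of_real x) + poly m (1 / of_real x) * poly q (1 / of_real x) = 0"
        if "complex_of_real x \<noteq> 0"
        using that root by (simp add: m_at vx)
    qed blast
    \<comment> \<open>For \<open>x = 0\<close> the degree is \<open>k\<close> and grows by 2,
      otherwise it is \<open>Suc k\<close> and grows by 1; both give \<open>k + 2\<close>.\<close>
    have "v (t k) = 1" if "x = 0" using that vx by simp
    then have "degree p' = Suc (Suc k)" using step(4) deg by (auto split: if_splits)
    moreover have "\<not> (y = 0 \<and> v (t (Suc k)) = 1)" using vy next_pt by auto
    moreover have "poly p' (1 / of_real y) + of_real (v (t (Suc k)) / y\<^sup>2) * poly q' (1 / of_real y) = 0"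
      if "y \<noteq> 0"
    proof -
      have "v (t (Suc k)) / y\<^sup>2 = - ((1 - a * y + c * y\<^sup>2) / y\<^sup>2)"
        unfolding next_pt vy by (rule minus_divide_left[symmetric])
      then have "of_real (v (t (Suc k)) / y\<^sup>2) = - poly m (1 / of_real y)"
        using m_at[OF that] by (simp only: of_real_minus)
      then show ?thesis using step(2)[of "1 / of_real y"] that by simp
    qed
    ultimately show ?thesis unfolding next_pt(1) using l \<mu>0 step(1,3)
      by (intro exI[of _ p'] exI[of _ q'] exI[of _ "l * of_real \<mu>"]) auto
  qed
qed

lemma flow_periods: "\<Phi> (t + real k * (w1 + w2)) = \<Phi> t + 2 * pi * real k"
proof (induction k)
  case (Suc k)
  have "t + real (Suc k) * (w1 + w2) = (t + real k * (w1 + w2)) + (w1 + w2)"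
    by (simp add: algebra_simps)
  then show ?case using flow_period[of "t + real k * (w1 + w2)"] Suc by (simp add: algebra_simps)
qed simp

lemma T_tuple_if_commensurable:
  assumes n: "n \<ge> 2" and k: "real n * w2 = real k * (w1 + w2)"
    and b: "b > 0" "a\<^sup>2 + b\<^sup>2 = s"
  shows "T_tuple n (-1) 1 (of_real a + \<i> * of_real b) (of_real a - \<i> * of_real b)"
proof -
  \<comment> \<open>If \<open>n * w2\<close> is a multiple of the period, then
    \<open>(n - 1) * w2\<close> is congruent to \<open>w1\<close>. There the moving zero is at
    infinity, so the norm is constant, and the degree is \<open>Suc (n - 1)\<close>.\<close>
  define t where "t = real (n - 1) * w2"
  have "t + (w1 + w2) = w1 + real k * (w1 + w2)"
    using n k by (simp add: t_def of_nat_diff algebra_simps)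
  then have "\<Phi> t + 2 * pi = pi + 2 * pi * real k"
    using flow_period[of t] flow_periods[of w1 k] by (simp only: flow_w1)
  then have shift: "\<Phi> t + 2 * pi = pi + 2 * real k * pi" by simp
  have "sin (\<Phi> t + 2 * pi) = 0" "cos (\<Phi> t + 2 * pi) = -1"
    unfolding shift by (simp_all only: sin_add cos_add sin_2npi cos_2npi) simp_all
  then have ut: "u t = 0" and vt: "v t = -1" by (simp_all add: u_def v_def d_def)
  obtain p q :: "complex poly" and l where l: "l \<noteq> 0" and norm: "p\<^sup>2 - H * q\<^sup>2 = [:l:]"
    and lead: "pell_lead p q" and deg: "degree p = n"
    using pell_orbit[of "n - 1"] n unfolding t_def[symmetric] ut vt by auto
  define r where "r = 1 / csqrt l"
  have r: "r\<^sup>2 * l = 1" "r \<noteq> 0" using l by (auto simp: r_def power_divide)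
  have q: "degree q + 2 = n" using lead deg n by (auto simp: pell_lead_def)
  have fac: "(z + 1) * (z - 1) * (z - (of_real a + \<i> * of_real b)) * (z - (of_real a - \<i> * of_real b))
      = poly H z" for z
  proof -
    have "complex_of_real s = (of_real a)\<^sup>2 + (of_real b)\<^sup>2" using b by (metis of_real_add of_real_power)
    moreover have "\<i> * \<i> = -1" by simp
    ultimately show ?thesis unfolding H_def by (simp del: i_squared) algebra
  qed
  have "(poly (smult r p) z)\<^sup>2 - (z + 1) * (z - 1) * (z - (of_real a + \<i> * of_real b)) *
      (z - (of_real a - \<i> * of_real b)) * (poly (smult r q) z)\<^sup>2 = 1" for z
  proof -
    have "(poly (smult r p) z)\<^sup>2 - poly H z * (poly (smult r q) z)\<^sup>2 = r\<^sup>2 * poly (p\<^sup>2 - H * q\<^sup>2) z"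
      by (simp add: power_mult_distrib algebra_simps)
    then show ?thesis using r unfolding fac norm by simp
  qed
  moreover have "distinct [-1, 1, of_real a + \<i> * of_real b, of_real a - \<i> * of_real b]"
    using b by (auto simp: complex_eq_iff)
  ultimately show ?thesis unfolding T_tuple_def using r deg q
    by (intro conjI exI[of _ "smult r p"] exI[of _ "smult r q"]) auto
qed

end

subsection \<open>Existence of the flow\<close>

text \<open>The integral of the invariant differential over the half of the oval with
  \<open>u \<ge> 0\<close>. As \<open>sin\<close> changes sign under a shift by \<open>pi\<close>,
  the other half is obtained from \<open>- a\<close>.\<close>

definition half_period :: "real \<Rightarrow> real \<Rightarrow> real" where
  "half_period s a = integral {0..pi} (\<lambda>\<phi>. 1 / sqrt (1 - 2 * a * sin \<phi> + s * (sin \<phi>)\<^sup>2))"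

lemma half_period_eq:
  assumes "\<And>x. (F has_real_derivative 1 / sqrt (1 - 2 * a * sin x + s * (sin x)\<^sup>2)) (at x)"
  shows "half_period s a = F pi - F 0"
proof -
  have "((\<lambda>\<phi>. 1 / sqrt (1 - 2 * a * sin \<phi> + s * (sin \<phi>)\<^sup>2)) has_integral F pi - F 0) {0..pi}"
    by (rule fundamental_theorem_of_calculus)
      (use assms in \<open>auto simp: has_real_derivative_iff_has_vector_derivative[symmetric]
          intro: DERIV_subset\<close>)
  then show ?thesis unfolding half_period_def by (rule integral_unique)
qed

text \<open>\<Phi> is the inverse of the incomplete elliptic integral \<open>F\<close>; its
  reflection and period laws are those of \<open>F\<close> under \<open>pi - x\<close> and
  \<open>x + 2 * pi\<close>.\<close>

lemma flow_exists:
  assumes as: "a\<^sup>2 < s"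
  obtains \<Phi> where "oval_flow a s (half_period s a) (half_period s (- a)) \<Phi>"
proof -
  define D where "D = (\<lambda>\<phi>. sqrt (1 - 2 * a * sin \<phi> + s * (sin \<phi>)\<^sup>2))"
  have s: "s > 0" using as by (smt (verit) zero_le_power2)
  have Dpos: "D \<phi> > 0" for \<phi> using quad_pos[OF as] by (simp add: D_def)
  have Dcont: "isCont D \<phi>" for \<phi> unfolding D_def by (intro continuous_intros)
  have Dn: "D \<phi> \<noteq> 0" for \<phi> using Dpos[of \<phi>] by simp
  have "\<exists>F. \<forall>x::real. - \<infinity> < ereal x \<longrightarrow> ereal x < \<infinity> \<longrightarrow>
      (F has_vector_derivative 1 / D x) (at x)"
    using Dn Dcont by (intro einterval_antiderivative) (auto intro!: continuous_intros)
  then obtain F0 where F0: "\<And>x. (F0 has_real_derivative 1 / D x) (at x)"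
    by (auto simp: has_real_derivative_iff_has_vector_derivative)
  define F where "F = (\<lambda>x. F0 x - F0 0)"
  have F: "(F has_real_derivative 1 / D x) (at x)" for x
    unfolding F_def using DERIV_diff[OF F0 DERIV_const] by simp
  have F00: "F 0 = 0" by (simp add: F_def)
  have Fpi: "half_period s a = F pi"
    using half_period_eq[of F a s] F F00 by (simp add: D_def)
  have const: "f x = f 0" if "\<And>x. (f has_real_derivative 0) (at x)" for f and x :: real
    using DERIV_isconst_all[of f] that by blast
  have Fpi2: "half_period s (- a) = F (2 * pi) - F pi"
  proof -
    have "((\<lambda>x. F (x + pi)) has_real_derivative 1 / D (x + pi) * 1) (at x)" for x
      by (rule DERIV_chain2[OF F]) (rule derivative_eq_intros refl | simp)+
    then have "((\<lambda>x. F (x + pi)) has_real_derivative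
        1 / sqrt (1 - 2 * (- a) * sin x + s * (sin x)\<^sup>2)) (at x)" for x
      by (simp add: D_def)
    from half_period_eq[OF this] show ?thesis by simp
  qed
  have Frefl: "F (pi - x) = F pi - F x" for x
  proof -
    have "((\<lambda>x. F (pi - x) + F x) has_real_derivative 1 / D (pi - x) * -1 + 1 / D x) (at x)" for x
      by (rule DERIV_add[OF DERIV_chain2[OF F] F]) (rule derivative_eq_intros refl | simp)+
    then have "((\<lambda>x. F (pi - x) + F x) has_real_derivative 0) (at x)" for x
      by (simp add: D_def)
    from const[OF this, of x] show ?thesis using F00 by simp
  qed
  have Fper: "F (x + 2 * pi) = F x + F (2 * pi)" for x
  proof -
    have "((\<lambda>x. F (x + 2 * pi) - F x) has_real_derivative 1 / D (x + 2 * pi) * 1 - 1 / D x) (at x)" for x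
      by (rule DERIV_diff[OF DERIV_chain2[OF F] F]) (rule derivative_eq_intros refl | simp)+
    then have "((\<lambda>x. F (x + 2 * pi) - F x) has_real_derivative 0) (at x)" for x
      by (simp add: D_def)
    from const[OF this, of x] show ?thesis using F00 by simp
  qed
  have Fmono: "F x < F y" if "x < y" for x y
    using DERIV_pos_imp_increasing[OF that, of F] F Dpos by (metis divide_pos_pos zero_less_one)
  have Fcont: "isCont F x" for x using F by (rule DERIV_isCont)
  \<comment> \<open>A lower bound for the slope of \<open>F\<close>, which makes \<open>F\<close>
    surjective.\<close>
  define k where "k = 1 / sqrt (1 + 2 * \<bar>a\<bar> + s)"
  have k: "k > 0" using s by (simp add: k_def)
  have kD: "k \<le> 1 / D x" for x
  proof -
    have "\<bar>a * sin x\<bar> \<le> \<bar>a\<bar>" by (simp add: abs_mult mult_left_le)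
    moreover have "s * (sin x)\<^sup>2 \<le> s" using s by (simp add: abs_square_le_1 mult_left_le)
    ultimately have "D x \<le> sqrt (1 + 2 * \<bar>a\<bar> + s)" unfolding D_def by (intro real_sqrt_le_mono) linarith
    then show ?thesis unfolding k_def using Dpos[of x] s by (intro divide_left_mono mult_pos_pos) auto
  qed
  have Fgrow: "F x - k * x \<le> F y - k * y" if "x \<le> y" for x y
  proof (rule DERIV_nonneg_imp_nondecreasing[OF that])
    fix z
    have "((\<lambda>x. F x - k * x) has_real_derivative 1 / D z - k) (at z)"
      by (rule derivative_eq_intros F refl | simp)+
    then show "\<exists>y. ((\<lambda>x. F x - k * x) has_real_derivative y) (at z) \<and> 0 \<le> y" using kD[of z] by force
  qed
  have surj: "\<exists>x. F x = t" for t
  proof -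
    have "F (- \<bar>t\<bar> / k) \<le> - \<bar>t\<bar>" "\<bar>t\<bar> \<le> F (\<bar>t\<bar> / k)"
      using Fgrow[of "- \<bar>t\<bar> / k" 0] Fgrow[of 0 "\<bar>t\<bar> / k"] k F00 by simp_all
    moreover have "- \<bar>t\<bar> / k \<le> \<bar>t\<bar> / k" using k by (simp add: divide_right_mono)
    ultimately show ?thesis using IVT[of F "- \<bar>t\<bar> / k" t "\<bar>t\<bar> / k"] Fcont
      by (metis abs_ge_self abs_ge_minus_self minus_le_iff order_trans)
  qed
  have inj: "inj F" by (intro injI) (metis Fmono less_irrefl linorder_less_linear)
  define \<Phi> where "\<Phi> = inv F"
  have F\<Phi>: "F (\<Phi> t) = t" for t unfolding \<Phi>_def using surj by (metis f_inv_into_f rangeI)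
  have \<Phi>F: "\<Phi> (F x) = x" for x unfolding \<Phi>_def using inj by simp
  have \<Phi>cont: "isCont \<Phi> t" for t
    using isCont_inverse_function[of 1 "\<Phi> t" \<Phi> F] \<Phi>F Fcont by (simp add: F\<Phi>)
  show thesis
  proof (rule that[of \<Phi>], unfold_locales)
    show "a\<^sup>2 < s" by fact
    show "\<Phi> 0 = 0" using \<Phi>F[of 0] F00 by simp
    show "(\<Phi> has_real_derivative sqrt (1 - 2 * a * sin (\<Phi> t) + s * (sin (\<Phi> t))\<^sup>2)) (at t)" for t
      using DERIV_inverse_function[OF F, of \<Phi> t "t - 1" "t + 1"] Dn F\<Phi> \<Phi>cont by (simp add: D_def)
    show "\<Phi> (half_period s a - t) = pi - \<Phi> t" for t
      using \<Phi>F[of "pi - \<Phi> t"] by (simp add: Frefl F\<Phi> Fpi)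
    show "\<Phi> (t + (half_period s a + half_period s (- a))) = \<Phi> t + 2 * pi" for t
      using \<Phi>F[of "\<Phi> t + 2 * pi"] by (simp add: Fper F\<Phi> Fpi Fpi2)
  qed
qed

subsection \<open>Variation of the rotation angle\<close>

lemma half_period_integrand_cont:
  assumes "a\<^sup>2 < s"
  shows "continuous_on S (\<lambda>\<phi>. 1 / sqrt (1 - 2 * a * sin \<phi> + s * (sin \<phi>)\<^sup>2))"
  using quad_pos[OF assms] by (intro continuous_intros) (auto simp: less_imp_neq[symmetric])

lemma half_period_integrable:
  assumes "a\<^sup>2 < s"
  shows "(\<lambda>\<phi>. 1 / sqrt (1 - 2 * a * sin \<phi> + s * (sin \<phi>)\<^sup>2)) integrable_on {c..d}"
  using half_period_integrand_cont[OF assms] by (rule integrable_continuous_real)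

lemma continuous_on_half_period:
  assumes "\<And>a. a \<in> A \<Longrightarrow> a\<^sup>2 < s"
  shows "continuous_on A (half_period s)"
proof -
  have "continuous_on A (\<lambda>a. integral (cbox 0 pi) (\<lambda>\<phi>. 1 / sqrt (1 - 2 * a * sin \<phi> + s * (sin \<phi>)\<^sup>2)))"
  proof (rule integral_continuous_on_param)
    show "continuous_on (A \<times> cbox 0 pi) (\<lambda>(a, \<phi>). 1 / sqrt (1 - 2 * a * sin \<phi> + s * (sin \<phi>)\<^sup>2))"
      unfolding case_prod_beta using quad_pos[OF assms]
      by (intro continuous_intros) (auto simp: less_imp_neq[symmetric])
  qed
  then show ?thesis by (simp add: half_period_def[abs_def])
qed

text \<open>For square roots \<open>y\<close>, \<open>z\<close> of the radicand, the numerator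
  \<open>z^2 - y^2\<close> is linear in the parameter \<open>a\<close>.\<close>

lemma inverse_diff_ge:
  fixes y z r :: real
  assumes "0 < y" "y \<le> z" "z \<le> r"
  shows "(z\<^sup>2 - y\<^sup>2) / (2 * r ^ 3) \<le> 1 / y - 1 / z"
proof -
  have "(z + y) * (y * z) \<le> (r + r) * (r * r)" using assms by (intro mult_mono add_mono) auto
  then have le: "(z + y) * (y * z) \<le> 2 * r ^ 3" by (simp add: power3_eq_cube)
  have p: "0 < (z + y) * (y * z)" using assms by simp
  have "(z\<^sup>2 - y\<^sup>2) / (2 * r ^ 3) \<le> (z\<^sup>2 - y\<^sup>2) / ((z + y) * (y * z))"
    using assms le p by (intro divide_left_mono) (auto intro!: mult_pos_pos simp: power_mono)
  also have "\<dots> = (z - y) / (y * z)"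
  proof -
    have "z\<^sup>2 - y\<^sup>2 = (z + y) * (z - y)" by algebra
    then show ?thesis using assms by simp
  qed
  also have "\<dots> = 1 / y - 1 / z" using assms by (simp add: field_simps)
  finally show ?thesis .
qed

lemma half_period_mono:
  assumes "a \<le> a'" "a\<^sup>2 < s" "a'\<^sup>2 < s"
  shows "half_period s a \<le> half_period s a'"
  unfolding half_period_def
proof (intro integral_le half_period_integrable assms)
  fix x :: real assume "x \<in> {0..pi}"
  then have "a * sin x \<le> a' * sin x" using assms by (intro mult_right_mono) (auto simp: sin_ge_zero)
  then show "1 / sqrt (1 - 2 * a * sin x + s * (sin x)\<^sup>2) \<le> 1 / sqrt (1 - 2 * a' * sin x + s * (sin x)\<^sup>2)"
    using quad_pos[OF assms(2), of "sin x"] quad_pos[OF assms(3), of "sin x"]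
    by (intro divide_left_mono mult_pos_pos) auto
qed

lemma half_period_growth:
  assumes "0 \<le> a" "a \<le> a'" "a'\<^sup>2 < s"
  shows "half_period s a + 2 * (a' - a) / sqrt (1 + s) ^ 3 \<le> half_period s a'"
proof -
  let ?f = "\<lambda>a \<phi>. 1 / sqrt (1 - 2 * a * sin \<phi> + s * (sin \<phi>)\<^sup>2)"
  have as: "a\<^sup>2 < s" using assms by (meson le_less_trans power_mono)
  then have s: "s > 0" by (smt (verit) zero_le_power2)
  \<comment> \<open>For \<open>0 \<le> a\<close> the radicand is at most \<open>1 + s\<close>, so
    the integrand grows by at least \<open>c * sin x\<close>, whose integral is
    \<open>2 * c\<close>.\<close>
  define c where "c = (a' - a) / sqrt (1 + s) ^ 3"
  have sin_int: "((\<lambda>x. c * sin x) has_integral c * 2) {0..pi}"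
  proof -
    have "(sin has_integral (- cos pi - - cos 0)) {0..pi}"
      by (rule fundamental_theorem_of_calculus)
        (auto intro!: derivative_eq_intros simp: has_real_derivative_iff_has_vector_derivative[symmetric])
    from has_integral_mult_right[OF this, of c] show ?thesis by simp
  qed
  have "integral {0..pi} (\<lambda>x. c * sin x) \<le> integral {0..pi} (\<lambda>x. ?f a' x - ?f a x)"
  proof (intro integral_le integrable_diff half_period_integrable as assms)
    show "(\<lambda>x. c * sin x) integrable_on {0..pi}" using sin_int by blast
    fix x :: real assume x: "x \<in> {0..pi}"
    let ?X = "\<lambda>a. 1 - 2 * a * sin x + s * (sin x)\<^sup>2"
    have sx: "0 \<le> sin x" using x by (simp add: sin_ge_zero)
    have pos: "0 < ?X a" "0 < ?X a'" using quad_pos as assms by blast+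
    have le: "a * sin x \<le> a' * sin x" using sx assms by (intro mult_right_mono)
    have "s * (sin x)\<^sup>2 \<le> s" using s by (simp add: abs_square_le_1 mult_left_le)
    moreover have "0 \<le> a * sin x" using sx assms by simp
    ultimately have "?X a \<le> 1 + s" by linarith
    then have "((sqrt (?X a))\<^sup>2 - (sqrt (?X a'))\<^sup>2) / (2 * sqrt (1 + s) ^ 3) \<le> ?f a' x - ?f a x"
      using pos le by (intro inverse_diff_ge) auto
    moreover have "(sqrt (?X a))\<^sup>2 - (sqrt (?X a'))\<^sup>2 = 2 * ((a' - a) * sin x)"
      using pos by (simp add: algebra_simps)
    ultimately show "c * sin x \<le> ?f a' x - ?f a x" unfolding c_def by simp
  qed
  also have "\<dots> = half_period s a' - half_period s a"
    unfolding half_period_def by (intro integral_diff half_period_integrable as assms)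
  finally have "c * 2 \<le> half_period s a' - half_period s a" using integral_unique[OF sin_int] by simp
  moreover have "c * 2 = 2 * (a' - a) / sqrt (1 + s) ^ 3" by (simp add: c_def)
  ultimately show ?thesis by linarith
qed

lemma half_period_ge:
  assumes as: "a\<^sup>2 < s" and sub: "{l..r} \<subseteq> {0..pi}" "l \<le> r" and "R > 0"
    and bound: "\<And>\<phi>. \<phi> \<in> {l..r} \<Longrightarrow> 1 - 2 * a * sin \<phi> + s * (sin \<phi>)\<^sup>2 \<le> R\<^sup>2"
  shows "(r - l) / R \<le> half_period s a"
proof -
  let ?f = "\<lambda>\<phi>. 1 / sqrt (1 - 2 * a * sin \<phi> + s * (sin \<phi>)\<^sup>2)"
  have "(r - l) / R = integral {l..r} (\<lambda>\<phi>. 1 / R)" using sub(2) by simp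
  also have "\<dots> \<le> integral {l..r} ?f"
  proof (intro integral_le half_period_integrable as)
    fix \<phi> assume "\<phi> \<in> {l..r}"
    then have "sqrt (1 - 2 * a * sin \<phi> + s * (sin \<phi>)\<^sup>2) \<le> R"
      using bound \<open>R > 0\<close> by (intro real_le_lsqrt) auto
    then show "1 / R \<le> ?f \<phi>" using quad_pos[OF as, of "sin \<phi>"] \<open>R > 0\<close>
      by (intro divide_left_mono mult_pos_pos) auto
  qed auto
  also have "\<dots> \<le> integral {0..pi} ?f"
    using quad_pos[OF as] by (intro integral_subset_le sub half_period_integrable as) (auto simp: less_imp_le)
  finally show ?thesis by (simp add: half_period_def)
qed

lemma half_period_pos:
  assumes as: "a\<^sup>2 < s"
  shows "half_period s a > 0"
proof -
  have s: "s > 0" using as by (smt (verit) zero_le_power2)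
  define R where "R = sqrt (1 + 2 * \<bar>a\<bar> + s)"
  have "R > 0" using s by (simp add: R_def)
  have "(pi - 0) / R \<le> half_period s a"
  proof (rule half_period_ge[OF as])
    fix \<phi>
    have "\<bar>a * sin \<phi>\<bar> \<le> \<bar>a\<bar>" by (simp add: abs_mult mult_left_le)
    moreover have "s * (sin \<phi>)\<^sup>2 \<le> s" using s by (simp add: abs_square_le_1 mult_left_le)
    moreover have "R\<^sup>2 = 1 + 2 * \<bar>a\<bar> + s" using s by (simp add: R_def)
    ultimately show "1 - 2 * a * sin \<phi> + s * (sin \<phi>)\<^sup>2 \<le> R\<^sup>2" by linarith
  qed (use \<open>R > 0\<close> in auto)
  moreover have "(pi - 0) / R > 0" using \<open>R > 0\<close> by simp
  ultimately show ?thesis by linarith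
qed

text \<open>Keeps \<open>w2\<close> bounded while \<open>w1\<close> blows up, so that the rotation
  angle becomes arbitrarily small.\<close>

lemma half_period_le_pi:
  assumes "a \<le> 0" "a\<^sup>2 < s"
  shows "half_period s a \<le> pi"
proof -
  have s: "s > 0" using assms by (smt (verit) zero_le_power2)
  have "half_period s a \<le> integral {0..pi} (\<lambda>x. 1)"
    unfolding half_period_def
  proof (intro integral_le half_period_integrable assms)
    fix x :: real assume "x \<in> {0..pi}"
    then have "a * sin x \<le> 0" using assms by (simp add: sin_ge_zero mult_nonpos_nonneg)
    moreover have "0 \<le> s * (sin x)\<^sup>2" using s by simp
    ultimately have "1 \<le> 1 - 2 * a * sin x + s * (sin x)\<^sup>2" by linarith
    then show "1 / sqrt (1 - 2 * a * sin x + s * (sin x)\<^sup>2) \<le> 1" by simp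
  qed auto
  then show ?thesis by simp
qed

text \<open>As \<open>a\<close> tends to \<open>1\<close> with \<open>s = 1\<close>, the integrand develops a pole at \<open>\<phi> = \<pi>/2\<close>.\<close>
lemma half_period_unbounded:
  assumes "0 < \<delta>" "\<delta> \<le> 1"
  defines "a \<equiv> 1 - \<delta> ^ 4 / 4"
  shows "0 < a" "a\<^sup>2 < 1" "2 / \<delta> \<le> half_period 1 a"
proof -
  have \<delta>4: "0 < \<delta> ^ 4" "\<delta> ^ 4 \<le> 1" using assms by (auto intro: power_le_one)
  then show "0 < a" and a1: "a\<^sup>2 < 1" by (auto simp: a_def abs_square_less_1)
  \<comment> \<open>On this window \<open>1 - sin \<phi> \<le> \<delta>^2 / 2\<close>, and with
    \<open>1 - a = \<delta>^4 / 4\<close> the radicand is at most \<open>\<delta>^4\<close>.\<close>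
  have "((pi / 2 + \<delta>) - (pi / 2 - \<delta>)) / \<delta>\<^sup>2 \<le> half_period 1 a"
  proof (rule half_period_ge[OF a1])
    show "{pi / 2 - \<delta>..pi / 2 + \<delta>} \<subseteq> {0..pi}" using assms pi_gt3 by auto
    fix \<phi> assume \<phi>: "\<phi> \<in> {pi / 2 - \<delta>..pi / 2 + \<delta>}"
    define x where "x = (\<phi> - pi / 2) / 2"
    have "2 * x = \<phi> - pi / 2" by (simp add: x_def)
    then have "sin \<phi> = cos (2 * x)" by (simp only: cos_diff) simp
    then have sx: "1 - sin \<phi> = 2 * (sin x)\<^sup>2" by (simp add: cos_double_sin)
    have "\<bar>sin x\<bar> \<le> \<delta> / 2" using abs_sin_x_le_abs_x[of x] \<phi> by (auto simp: x_def abs_le_iff)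
    then have "(sin x)\<^sup>2 \<le> (\<delta> / 2)\<^sup>2" by (metis abs_ge_zero power2_abs power_mono)
    then have "1 - sin \<phi> \<le> \<delta>\<^sup>2 / 2" "0 \<le> 1 - sin \<phi>" using sx by (auto simp: power_divide)
    then have "(1 - sin \<phi>)\<^sup>2 \<le> (\<delta>\<^sup>2 / 2)\<^sup>2" by (intro power_mono)
    also have "\<dots> = \<delta> ^ 4 / 4" by (simp add: power_divide)
    finally have 1: "(1 - sin \<phi>)\<^sup>2 \<le> \<delta> ^ 4 / 4" .
    have 2: "\<delta> ^ 4 / 2 * sin \<phi> \<le> \<delta> ^ 4 / 2 * 1" using \<delta>4 by (intro mult_left_mono) auto
    have "1 - 2 * a * sin \<phi> + 1 * (sin \<phi>)\<^sup>2 = (1 - sin \<phi>)\<^sup>2 + \<delta> ^ 4 / 2 * sin \<phi>"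
      by (simp add: a_def power2_eq_square algebra_simps)
    also have "\<dots> \<le> \<delta> ^ 4" using 1 2 \<delta>4 by linarith
    finally show "1 - 2 * a * sin \<phi> + 1 * (sin \<phi>)\<^sup>2 \<le> (\<delta>\<^sup>2)\<^sup>2" by (simp flip: power_mult)
  qed (use assms in auto)
  then show "2 / \<delta> \<le> half_period 1 a" using assms by (simp add: power2_eq_square)
qed

text \<open>The translation by \<open>w2\<close> as a fraction of the period \<open>w1 + w2\<close> of the oval.\<close>
definition rotation :: "real \<Rightarrow> real \<Rightarrow> real" where
  "rotation s a = half_period s (- a) / (half_period s a + half_period s (- a))"

section \<open>From rational rotation angles to tuples\<close>

lemma T_tuple_if_rotation:
  assumes "n \<ge> 2" and b: "b > 0" "a\<^sup>2 + b\<^sup>2 = s" and rot: "real n * rotation s a = real k"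
  shows "T_tuple n (-1) 1 (of_real a + \<i> * of_real b) (of_real a - \<i> * of_real b)"
proof -
  have as: "a\<^sup>2 < s" using b by (smt (verit) zero_less_power)
  have "half_period s a + half_period s (- a) > 0"
    using half_period_pos[of a s] half_period_pos[of "- a" s] as by simp
  then have "real n * half_period s (- a) = real k * (half_period s a + half_period s (- a))"
    using rot by (simp add: rotation_def field_simps)
  moreover obtain \<Phi> where "oval_flow a s (half_period s a) (half_period s (- a)) \<Phi>"
    using flow_exists[OF as] .
  ultimately show ?thesis using oval_flow.T_tuple_if_commensurable assms by blast
qed

lemma rotation_IVT:
  assumes "0 \<le> a" "a \<le> a'" "a'\<^sup>2 < s" "rotation s a' \<le> r" "r \<le> rotation s a"
  obtains x where "a \<le> x" "x \<le> a'" "rotation s x = r"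
proof -
  have lt: "x\<^sup>2 < s" if "x \<in> {a..a'}" for x
  proof -
    have "x\<^sup>2 \<le> a'\<^sup>2" using that assms by (intro power_mono) auto
    then show ?thesis using assms by linarith
  qed
  have c1: "continuous_on {a..a'} (half_period s)" using lt by (rule continuous_on_half_period)
  have "continuous_on (uminus ` {a..a'}) (half_period s)"
    by (rule continuous_on_half_period) (use lt in force)
  then have c2: "continuous_on {a..a'} (\<lambda>x. half_period s (- x))"
    by (rule continuous_on_compose2) (auto intro: continuous_intros)
  have "half_period s x + half_period s (- x) \<noteq> 0" if "x \<in> {a..a'}" for x
    using half_period_pos[of x s] half_period_pos[of "- x" s] lt[OF that] by simp
  then have "continuous_on {a..a'} (rotation s)"
    unfolding rotation_def[abs_def] using c1 c2 by (intro continuous_intros) auto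
  then show thesis using IVT2'[of "rotation s" a' r a] assms that by auto
qed

lemma T_tuple_exists:
  assumes "n \<ge> 3"
  obtains a b :: real where "a > 0" "b > 0"
    "T_tuple n (-1) 1 (of_real a + \<i> * of_real b) (of_real a - \<i> * of_real b)"
proof -
  \<comment> \<open>Chosen so that \<open>2 / \<delta> = n * pi\<close>; as the other half period is
    at most \<open>pi\<close>, the angle at \<open>a\<close> is at most
    \<open>1 / n\<close>.\<close>
  define \<delta> where "\<delta> = 2 / (real n * pi)"
  have n: "real n \<ge> 3" using assms by simp
  have "3 * 3 \<le> real n * pi" using n pi_gt3 by (intro mult_mono) auto
  then have \<delta>: "0 < \<delta>" "\<delta> \<le> 1" by (auto simp: \<delta>_def field_simps)
  define a where "a = 1 - \<delta> ^ 4 / 4"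
  have a: "0 < a" "a\<^sup>2 < 1" "real n * pi \<le> half_period 1 a"
    using half_period_unbounded[OF \<delta>] by (simp_all add: a_def \<delta>_def)
  have "real n * half_period 1 (- a) \<le> real n * pi"
    using half_period_le_pi[of "- a" 1] a by (intro mult_left_mono) auto
  then have "real n * half_period 1 (- a) \<le> half_period 1 a + half_period 1 (- a)"
    using a half_period_pos[of "- a" 1] by simp
  then have "rotation 1 a \<le> 1 / real n"
    using half_period_pos[of "- a" 1] half_period_pos[of a 1] a n
    by (simp add: rotation_def field_simps)
  moreover have rot0: "rotation 1 0 = 1 / 2"
    using half_period_pos[of 0 1] by (simp add: rotation_def)
  moreover have "1 / real n \<le> 1 / 2" using n by (simp add: field_simps)
  ultimately obtain x where x: "0 \<le> x" "x \<le> a" "rotation 1 x = 1 / real n"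
    using rotation_IVT[of 0 a 1 "1 / real n"] a by auto
  \<comment> \<open>At \<open>x = 0\<close> the two half periods coincide and the angle is
    \<open>1/2\<close>; here \<open>n \<ge> 3\<close> enters.\<close>
  have "x \<noteq> 0"
  proof
    assume "x = 0"
    then have "1 / real n = 1 / 2" using x(3) rot0 by simp
    then show False using n by simp
  qed
  have "x\<^sup>2 \<le> a\<^sup>2" using x by (intro power_mono)
  then have "x\<^sup>2 < 1" using a by linarith
  show thesis
  proof (rule that)
    show "x > 0" "sqrt (1 - x\<^sup>2) > 0" using \<open>x \<noteq> 0\<close> x \<open>x\<^sup>2 < 1\<close> by auto
    then show "T_tuple n (-1) 1 (of_real x + \<i> * of_real (sqrt (1 - x\<^sup>2)))
        (of_real x - \<i> * of_real (sqrt (1 - x\<^sup>2)))"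
      using x n assms \<open>x\<^sup>2 < 1\<close> by (intro T_tuple_if_rotation[of n _ x 1 1]) auto
  qed
qed

text \<open>As \<open>a\<close> grows, \<open>half_period s a\<close> grows at least linearly and
  \<open>half_period s (- a)\<close> does not increase.\<close>

lemma rotation_decrease:
  assumes "0 \<le> a" "a \<le> a'" "a'\<^sup>2 < s"
  obtains \<kappa> where "\<kappa> > 0"
    "\<And>x. x \<in> {a..a'} \<Longrightarrow> \<kappa> * (x - a) \<le> rotation s a - rotation s x"
proof -
  have lt: "x\<^sup>2 < s" if "x \<in> {a..a'}" for x
  proof -
    have "x\<^sup>2 \<le> a'\<^sup>2" using that assms by (intro power_mono) auto
    then show ?thesis using assms by linarith
  qed
  have s: "s > 0" using assms by (smt (verit) zero_le_power2)
  define p q c where "p = half_period s a" and "q = half_period s (- a)"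
    and "c = 2 / sqrt (1 + s) ^ 3"
  have pos: "p > 0" "q > 0" "c > 0"
    using half_period_pos lt[of a] assms s by (auto simp: p_def q_def c_def)
  \<comment> \<open>The largest denominator, attained at \<open>x = a'\<close>, so that one rate
    serves the whole interval.\<close>
  define Q where "Q = (p + q) * (p + q + c * (a' - a))"
  have Q: "Q > 0" unfolding Q_def using pos assms by (intro mult_pos_pos add_pos_nonneg) auto
  show thesis
  proof (rule that)
    show "q * c / Q > 0" using pos Q by simp
    fix x assume x: "x \<in> {a..a'}"
    define P R where "P = half_period s x" and "R = half_period s (- x)"
    have P: "p + c * (x - a) \<le> P"
      using half_period_growth[of a x s] x assms lt[OF x] by (simp add: p_def P_def c_def algebra_simps)
    have R: "R > 0" "R \<le> q"
      using half_period_pos[of "- x" s] half_period_mono[of "- x" "- a" s] x assms lt[OF x] lt[of a]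
      by (auto simp: R_def q_def)
    let ?h = "c * (x - a)"
    have h: "0 \<le> ?h" "?h \<le> c * (a' - a)" using pos x by auto
    have PR: "P + R \<noteq> 0" using P R pos h by linarith
    then have "rotation s x = 1 - P / (P + R)"
      by (simp add: rotation_def P_def[symmetric] R_def[symmetric] diff_divide_eq_iff)
    also have "\<dots> \<le> 1 - (p + ?h) / (p + ?h + q)"
    proof -
      have "(p + ?h) * R \<le> P * q" using P R pos h by (intro mult_mono) auto
      then have "(p + ?h) * (P + R) \<le> P * (p + ?h + q)" by (simp add: algebra_simps)
      moreover have "0 < p + ?h + q" "0 < P + R" using P R pos h by linarith+
      ultimately have "(p + ?h) / (p + ?h + q) \<le> P / (P + R)"
        by (simp only: pos_divide_le_eq pos_le_divide_eq times_divide_eq_left)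
      then show ?thesis by simp
    qed
    also have "\<dots> = q / (p + q + ?h)"
    proof -
      have "p + ?h + q \<noteq> 0" using pos h by linarith
      then have "1 - (p + ?h) / (p + ?h + q) = (p + ?h + q - (p + ?h)) / (p + ?h + q)"
        by (simp only: diff_divide_distrib[of "p + ?h + q"] divide_self not_False_eq_True)
      then show ?thesis by (simp add: ac_simps)
    qed
    finally have "rotation s a - rotation s x \<ge> q / (p + q) - q / (p + q + ?h)"
      by (simp add: rotation_def p_def q_def)
    also have "q / (p + q) - q / (p + q + ?h) = q * ?h / ((p + q) * (p + q + ?h))"
      using pos h by (simp add: divide_simps) (simp add: algebra_simps)
    also have "\<dots> \<ge> q * ?h / Q"
    proof -
      have "0 < p + q + ?h" "p + q + ?h \<le> p + q + c * (a' - a)" using pos h by linarith+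
      then have "(p + q) * (p + q + ?h) \<le> Q" "0 < (p + q) * (p + q + ?h)"
        unfolding Q_def using pos by (auto intro!: mult_left_mono mult_pos_pos)
      then show ?thesis
        using pos h Q by (intro divide_left_mono mult_pos_pos[of Q]) auto
    qed
    finally show "q * c / Q * (x - a) \<le> rotation s a - rotation s x" by simp
  qed
qed

lemma T_tuple_near:
  fixes \<alpha> \<beta> :: real
  assumes "\<alpha> > 0" and "\<beta> > 0"
  obtains B N where "\<And>n. n \<ge> N \<Longrightarrow> \<exists>a b. a > 0 \<and> b > 0 \<and>
     T_tuple n (-1) 1 (of_real a + \<i> * of_real b) (of_real a - \<i> * of_real b) \<and>
     \<bar>\<alpha> - a\<bar> + \<bar>\<beta> - b\<bar> \<le> B / real n"
proof -
  define s where "s = \<alpha>\<^sup>2 + \<beta>\<^sup>2"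
  have s: "s > 0" using assms by (simp add: s_def add_pos_pos)
  have "\<alpha> < sqrt s" unfolding s_def using assms by (intro real_less_rsqrt) auto
  \<comment> \<open>A fixed margin to the right of \<alpha> makes the rate \<kappa> independent of
    \<open>n\<close>.\<close>
  then obtain \<gamma> where \<gamma>: "\<alpha> < \<gamma>" "\<gamma> < sqrt s" using dense by blast
  have "\<gamma>\<^sup>2 < (sqrt s)\<^sup>2" using \<gamma> assms by (intro power_strict_mono) auto
  then have \<gamma>s: "\<gamma>\<^sup>2 < s" using s by simp
  obtain \<kappa> where \<kappa>: "\<kappa> > 0" "\<And>x. x \<in> {\<alpha>..\<gamma>} \<Longrightarrow> \<kappa> * (x - \<alpha>) \<le> rotation s \<alpha> - rotation s x"
    using rotation_decrease[of \<alpha> \<gamma> s] assms \<gamma> \<gamma>s by auto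
  define N where "N = max 2 (nat \<lceil>1 / (\<kappa> * (\<gamma> - \<alpha>))\<rceil>)"
  show thesis
  proof (rule that[of N "(1 + 2 * sqrt s / \<beta>) / \<kappa>"])
    fix n assume n: "n \<ge> N"
    then have n2: "n \<ge> 2" and "1 / (\<kappa> * (\<gamma> - \<alpha>)) \<le> real n" by (auto simp: N_def nat_le_iff ceiling_le_iff)
    then have small: "1 / (\<kappa> * real n) \<le> \<gamma> - \<alpha>" using \<kappa> \<gamma> by (simp add: field_simps)
    have n0: "real n > 0" using n2 by simp
    \<comment> \<open>Over this distance \<open>n * rotation\<close> drops by at least 1 and so
      meets an integer.\<close>
    define a' where "a' = \<alpha> + 1 / (\<kappa> * real n)"
    have a': "\<alpha> < a'" "a' \<le> \<gamma>" using small \<kappa> n0 by (auto simp: a'_def)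
    have "a'\<^sup>2 \<le> \<gamma>\<^sup>2" using a' assms by (intro power_mono) auto
    then have a's: "a'\<^sup>2 < s" using \<gamma>s by linarith
    have "1 / real n \<le> rotation s \<alpha> - rotation s a'" using \<kappa>(2)[of a'] a' \<kappa>(1) by (simp add: a'_def)
    then have "1 \<le> (rotation s \<alpha> - rotation s a') * real n" using n0 by (simp add: pos_divide_le_eq)
    then have gap: "real n * rotation s a' + 1 \<le> real n * rotation s \<alpha>" by (simp add: algebra_simps)
    have "rotation s a' \<ge> 0"
      using half_period_pos[of a' s] half_period_pos[of "- a'" s] a's by (simp add: rotation_def)
    then have "real n * rotation s a' \<ge> 0" by simp
    define k where "k = nat \<lfloor>real n * rotation s \<alpha>\<rfloor>"
    have "real k = of_int \<lfloor>real n * rotation s \<alpha>\<rfloor>"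
      using gap \<open>real n * rotation s a' \<ge> 0\<close> by (simp add: k_def)
    then have "real n * rotation s a' \<le> real k" "real k \<le> real n * rotation s \<alpha>" using gap by linarith+
    then have "rotation s a' \<le> real k / real n" "real k / real n \<le> rotation s \<alpha>"
      using n0 by (simp_all add: field_simps)
    then obtain a where a: "\<alpha> \<le> a" "a \<le> a'" "rotation s a = real k / real n"
      using rotation_IVT[of \<alpha> a' s "real k / real n"] a' a's assms by auto
    have "a\<^sup>2 \<le> a'\<^sup>2" using a assms by (intro power_mono) auto
    then have "a\<^sup>2 < s" using a's by linarith
    define b where "b = sqrt (s - a\<^sup>2)"
    have b: "b > 0" "a\<^sup>2 + b\<^sup>2 = s" using \<open>a\<^sup>2 < s\<close> by (auto simp: b_def)
    have T: "T_tuple n (-1) 1 (of_real a + \<i> * of_real b) (of_real a - \<i> * of_real b)"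
      using a n0 by (intro T_tuple_if_rotation[OF n2 b, of k]) simp
    have "a < sqrt s" "\<alpha> < sqrt s" using a a' \<gamma> by linarith+
    then have sum: "a + \<alpha> \<le> 2 * sqrt s" by linarith
    have d: "a - \<alpha> \<le> 1 / (\<kappa> * real n)" using a by (simp add: a'_def)
    \<comment> \<open>Both points lie on the circle of radius \<open>sqrt s\<close>, so the error in
      \<open>b\<close> is controlled by the error in \<open>a\<close>.\<close>
    have sq: "(\<beta> + b) * (\<beta> - b) = (a + \<alpha>) * (a - \<alpha>)"
      using b(2) unfolding s_def by algebra
    have "0 \<le> (a + \<alpha>) * (a - \<alpha>)" using a assms by simp
    then have "\<beta> \<ge> b" using sq assms b by (metis add_pos_pos diff_ge_0_iff_ge zero_le_mult_iff less_le_not_le)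
    then have "\<beta> * (\<beta> - b) \<le> (\<beta> + b) * (\<beta> - b)" using b by (intro mult_right_mono) auto
    also have "\<dots> \<le> 2 * sqrt s * (a - \<alpha>)" unfolding sq using sum a by (intro mult_right_mono) auto
    finally have "\<beta> - b \<le> 2 * sqrt s / \<beta> * (a - \<alpha>)" using assms by (simp add: field_simps)
    then have "\<bar>\<alpha> - a\<bar> + \<bar>\<beta> - b\<bar> \<le> (1 + 2 * sqrt s / \<beta>) * (a - \<alpha>)"
      using a \<open>\<beta> \<ge> b\<close> by (simp add: algebra_simps)
    also have "\<dots> \<le> (1 + 2 * sqrt s / \<beta>) * (1 / (\<kappa> * real n))"
      using d s assms by (intro mult_left_mono) auto
    finally have "\<bar>\<alpha> - a\<bar> + \<bar>\<beta> - b\<bar> \<le> (1 + 2 * sqrt s / \<beta>) / \<kappa> / real n" by simp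
    with T a b assms show "\<exists>a b. a > 0 \<and> b > 0 \<and>
       T_tuple n (-1) 1 (of_real a + \<i> * of_real b) (of_real a - \<i> * of_real b) \<and>
       \<bar>\<alpha> - a\<bar> + \<bar>\<beta> - b\<bar> \<le> (1 + 2 * sqrt s / \<beta>) / \<kappa> / real n"
      by (intro exI[of _ a] exI[of _ b]) auto
  qed
qed

theorem theorem5:
  fixes \<alpha> \<beta> :: real
  assumes "\<alpha> > 0" and "\<beta> > 0"
  shows "\<exists>A::real. \<forall>n::nat. n \<ge> 3 \<longrightarrow>
           (\<exists>\<alpha>' \<beta>' :: real. \<alpha>' > 0 \<and> \<beta>' > 0 \<and>
              T_tuple n (-1) 1 (of_real \<alpha>' + \<i> * of_real \<beta>') (of_real \<alpha>' - \<i> * of_real \<beta>') \<and>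
              cmod ((of_real \<alpha> + \<i> * of_real \<beta>) - (of_real \<alpha>' + \<i> * of_real \<beta>')) \<le> A / real n)"
proof -
  define T where "T = (\<lambda>n a b. a > 0 \<and> b > 0 \<and>
    T_tuple n (-1) 1 (of_real a + \<i> * of_real b) (of_real a - \<i> * of_real b))"
  have dist: "cmod ((of_real \<alpha> + \<i> * of_real \<beta>) - (of_real a + \<i> * of_real b)) \<le> \<bar>\<alpha> - a\<bar> + \<bar>\<beta> - b\<bar>"
    for a b :: real
    using cmod_le[of "(of_real \<alpha> + \<i> * of_real \<beta>) - (of_real a + \<i> * of_real b)"] by simp
  obtain B N where near: "\<And>n. n \<ge> N \<Longrightarrow> \<exists>a b. T n a b \<and> \<bar>\<alpha> - a\<bar> + \<bar>\<beta> - b\<bar> \<le> B / real n"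
    using T_tuple_near[OF assms] unfolding T_def by (metis (no_types, lifting))
  have "\<forall>n. \<exists>a b. n \<ge> 3 \<longrightarrow> T n a b" unfolding T_def using T_tuple_exists by metis
  then obtain f g where fg: "\<And>n. n \<ge> 3 \<Longrightarrow> T n (f n) (g n)" by metis
  define e where "e = (\<lambda>n. \<bar>\<alpha> - f n\<bar> + \<bar>\<beta> - g n\<bar>)"
  \<comment> \<open>The sum dominates each \<open>n * e n\<close> with \<open>n < N\<close>. The
    terms with \<open>n < 3\<close> hold arbitrary values but are nonnegative.\<close>
  define A where "A = \<bar>B\<bar> + (\<Sum>n<N. real n * e n)"
  have e0: "real n * e n \<ge> 0" for n by (simp add: e_def)
  have "\<exists>a b. T n a b \<and> \<bar>\<alpha> - a\<bar> + \<bar>\<beta> - b\<bar> \<le> A / real n" if n: "n \<ge> 3" for n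
  proof (cases "n \<ge> N")
    case True
    have "B \<le> A" using sum_nonneg[of "{..<N}" "\<lambda>n. real n * e n"] e0 by (simp add: A_def)
    then have "B / real n \<le> A / real n" by (simp add: divide_right_mono)
    then show ?thesis using near[OF True] by (meson order_trans)
  next
    case False
    then have "real n * e n \<le> (\<Sum>n<N. real n * e n)" using e0 by (intro member_le_sum) auto
    then have "real n * e n \<le> A" by (simp add: A_def)
    then have "e n \<le> A / real n" using n by (simp add: field_simps)
    then show ?thesis using fg[OF n] unfolding e_def by blast
  qed
  then show ?thesis using dist unfolding T_def by (meson order_trans)
qed

end
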